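(* Let $m\ge 3$ and let the aggregation function $t$ be given by $$t(x_1,x_2,\dots,x_m)=\min(x_1+x_2,\,x_3,\dots,x_m).$$ Let $\mathbf{D}$ be the class of all databases (with $m$ sorted lists) that satisfy the distinctness property. Let $\mathbf{A}$ be the class of all algorithms that correctly find the top $k$ objects for $t$ for every database in $\mathbf{D}$. There is no deterministic algorithm that is instance optimal over $\mathbf{A}$ and $\mathbf{D}$ with optimality ratio less than $\frac{m-2}{2}\,\frac{c_R}{c_S}$.
   Context: Setting: fix a positive integer $k$ (and $m$; both treated as constants). A database consists of a finite set of $N\ge k$ objects; each object $R$ has $m$ grades (fields) $x_1,\dots,x_m\in[0,1]$. It is presented as $m$ sorted lists $L_1,\dots,L_m$ of length $N$; list $L_i$ contains one entry $(R,x_i)$ for each object $R$, in descending order of $x_i$. A database satisfies the distinctness property if for each $i$ no two objects have the same grade in list $L_i$. The overall grade of $R$ is $t(R)=t(x_1,\dots,x_m)$. Finding the top $k$ objects means outputting $k$ objects with the highest overall grades (ties broken arbitrarily), without necessarily giving their grades. Access and cost: an algorithm obtains information about the database only by sorted access (reading the next entry of some list, proceeding sequentially from the top) and random access (requesting the grade of a given object in a given list, obtained in one step; the object may be one not previously seen). Internal computation is free. With $s$ sorted and $r$ random accesses the middleware cost is $s c_S+r c_R$, where $c_S,c_R>0$ are fixed constants; $cost(\mathcal A,\mathcal D)$ is the middleware cost of algorithm $\mathcal A$ on database $\mathcal D$. Instance optimality: algorithm $\mathcal B$ is instance optimal over $\mathbf A$ and $\mathbf D$ with optimality ratio $c$ if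 $\mathcal B\in\mathbf A$ and there is a constant $c'$ such that $cost(\mathcal B,\mathcal D)\le c\cdot cost(\mathcal A,\mathcal D)+c'$ for every $\mathcal A\in\mathbf A$ and $\mathcal D\in\mathbf D$. *)

theory Defs
  imports Complex_Main "HOL-Library.Infinite_Typeclass"
begin

text \<open>
  A database is given by its sorted lists; lists and fields are numbered from 0. An object
  is an element of \<^typ>\<open>'a\<close>, which plays the role of the (infinite) universe of possible objects;
  the finitely many objects of a particular database are those occurring in its lists.
\<close>

type_synonym 'a database = "('a \<times> real) list list"

definition objects :: "'a database \<Rightarrow> 'a set" where
  "objects D = (\<Union>L\<in>set D. fst ` set L)"

definition is_database :: "nat \<Rightarrow> nat \<Rightarrow> 'a database \<Rightarrow> bool" where
  "is_database m k D \<longleftrightarrow>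
     length D = m \<and> k \<le> card (objects D) \<and>
     (\<forall>L\<in>set D. distinct (map fst L) \<and> fst ` set L = objects D \<and>
        snd ` set L \<subseteq> {0..1} \<and> sorted_wrt (\<ge>) (map snd L))"

definition distinctness :: "'a database \<Rightarrow> bool" where
  "distinctness D \<longleftrightarrow> (\<forall>L\<in>set D. distinct (map snd L))"

definition distinct_databases :: "nat \<Rightarrow> nat \<Rightarrow> 'a database set" where
  "distinct_databases m k = {D. is_database m k D \<and> distinctness D}"

definition grades :: "'a database \<Rightarrow> 'a \<Rightarrow> real list" where
  "grades D R = map (\<lambda>L. the (map_of L R)) D"

text \<open>An aggregation function takes the list of the \<open>m\<close> grades of an object.\<close>

definition top_k :: "(real list \<Rightarrow> real) \<Rightarrow> nat \<Rightarrow> 'a database \<Rightarrow> 'a set \<Rightarrow> bool" where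
  "top_k t k D X \<longleftrightarrow> X \<subseteq> objects D \<and> card X = k \<and>
     (\<forall>R\<in>X. \<forall>S\<in>objects D - X. t (grades D S) \<le> t (grades D R))"

definition min_agg :: "real list \<Rightarrow> real" where
  "min_agg xs = Min (insert (xs ! 0 + xs ! 1) (set (drop 2 xs)))"

text \<open>
  A (deterministic) algorithm chooses its next step from the accesses made so far and the answers
  received; it has no other information on the database (neither the set of objects nor its
  size). A sorted access is answered by \<^const>\<open>None\<close> when the list is exhausted, a random access
  when the requested object does not belong to the database.
\<close>

datatype 'a access = Sorted nat | Random 'a nat

datatype 'a answer = Entry "('a \<times> real) option" | Grade "real option"

type_synonym 'a history = "('a access \<times> 'a answer) list"

datatype 'a step = Access "'a access" | Halt "'a set"

type_synonym 'a algorithm = "'a history \<Rightarrow> 'a step"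

definition num_accesses :: "('a access \<Rightarrow> bool) \<Rightarrow> 'a history \<Rightarrow> nat" where
  "num_accesses P h = length (filter (\<lambda>(q, a). P q) h)"

fun reply :: "'a database \<Rightarrow> 'a history \<Rightarrow> 'a access \<Rightarrow> 'a answer" where
  "reply D h (Sorted i) =
     (let p = num_accesses (\<lambda>q. q = Sorted i) h
      in Entry (if i < length D \<and> p < length (D ! i) then Some (D ! i ! p) else None))"
| "reply D h (Random R i) = Grade (if i < length D then map_of (D ! i) R else None)"

text \<open>The history after at most \<open>n\<close> accesses; it stays constant once the algorithm has halted.\<close>

fun run :: "'a algorithm \<Rightarrow> 'a database \<Rightarrow> nat \<Rightarrow> 'a history" where
  "run A D 0 = []"
| "run A D (Suc n) =
     (let h = run A D n
      in case A h of Access q \<Rightarrow> h @ [(q, reply D h q)] | Halt X \<Rightarrow> h)"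

definition halts_after :: "'a algorithm \<Rightarrow> 'a database \<Rightarrow> nat \<Rightarrow> 'a set \<Rightarrow> bool" where
  "halts_after A D n X \<longleftrightarrow> A (run A D n) = Halt X"

definition correct_algorithms ::
    "(real list \<Rightarrow> real) \<Rightarrow> nat \<Rightarrow> 'a database set \<Rightarrow> 'a algorithm set" where
  "correct_algorithms t k \<D> = {A. \<forall>D\<in>\<D>. \<exists>n X. halts_after A D n X \<and> top_k t k D X}"

text \<open>Meaningful only if \<open>A\<close> halts on \<open>D\<close>, as the algorithms in \<^const>\<open>correct_algorithms\<close> do.\<close>

definition final_history :: "'a algorithm \<Rightarrow> 'a database \<Rightarrow> 'a history" where
  "final_history A D = run A D (LEAST n. \<exists>X. halts_after A D n X)"

definition cost :: "real \<Rightarrow> real \<Rightarrow> 'a algorithm \<Rightarrow> 'a database \<Rightarrow> real" where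
  "cost cS cR A D =
     real (num_accesses (\<lambda>q. \<exists>i. q = Sorted i) (final_history A D)) * cS +
     real (num_accesses (\<lambda>q. \<exists>R i. q = Random R i) (final_history A D)) * cR"

definition instance_optimal ::
    "real \<Rightarrow> real \<Rightarrow> 'a algorithm set \<Rightarrow> 'a database set \<Rightarrow> 'a algorithm \<Rightarrow> real \<Rightarrow> bool" where
  "instance_optimal cS cR \<A> \<D> B c \<longleftrightarrow> B \<in> \<A> \<and>
     (\<exists>c'. \<forall>A\<in>\<A>. \<forall>D\<in>\<D>. cost cS cR B D \<le> c * cost cS cR A D + c')"

end

theory Submission
  imports Defs
begin

text \<open>
  Let \<open>n\<close> candidate objects have first two grades adding up to exactly 1/2, and occupy the top of
  the first two lists in opposite orders; in every other list they are preceded by a long run of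
  objects whose first two grades are tiny. Besides \<open>k - 1\<close> fixed winners there is a single winning
  candidate, whose other grades all exceed 1/2, while every other candidate has one small grade.
  With \<open>2 * (n + 1)\<close> sorted accesses in the first two lists and \<open>k * m\<close> random accesses to the
  grades of the winners one verifies that no object exceeds 1/2. An algorithm that does not know the
  winning candidate has to find it by random accesses, and an adversary who reveals the small grade
  of a candidate only at the last possible moment forces \<open>(m - 2) * (n - k)\<close> of them. The ratio of
  the costs tends to \<open>(m - 2) / 2 * (c\<^sub>R / c\<^sub>S)\<close> as \<open>n\<close> grows.
\<close>

section \<open>Histories\<close>

lemma num_accesses_Nil [simp]: "num_accesses P [] = 0"
  by (simp add: num_accesses_def)

lemma num_accesses_append [simp]:
  "num_accesses P (h @ h') = num_accesses P h + num_accesses P h'"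
  by (simp add: num_accesses_def)

lemma num_accesses_single [simp]: "num_accesses P [(q, a)] = (if P q then 1 else 0)"
  by (simp add: num_accesses_def)

lemma num_accesses_conv_filter: "num_accesses P h = length (filter P (map fst h))"
  by (simp add: num_accesses_def filter_map comp_def case_prod_unfold)

lemma num_accesses_le_length: "num_accesses P h \<le> length h"
  by (simp add: num_accesses_def)

lemma num_accesses_Sorted_plus_Random:
  "num_accesses (\<lambda>q. \<exists>i. q = Sorted i) h + num_accesses (\<lambda>q. \<exists>R i. q = Random R i) h = length h"
proof (induction h rule: rev_induct)
  case (snoc x h)
  obtain q a where "x = (q, a)" by fastforce
  with snoc show ?case by (cases q) auto
qed simp

text \<open>The count grows by one at each access satisfying \<open>P\<close>, so it equals
  \<open>p\<close> just before one of them. For sorted accesses to a list, \<open>p\<close> is the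
  position read, which traces an answer to its entry.\<close>

lemma num_accesses_nth_occurrence:
  assumes "p < num_accesses P h"
  obtains l where "l < length h" "P (fst (h ! l))" "num_accesses P (take l h) = p"
proof -
  have "\<exists>l<length h. P (fst (h ! l)) \<and> num_accesses P (take l h) = p"
    using assms
  proof (induction h rule: rev_induct)
    case (snoc x h)
    obtain q a where x: "x = (q, a)" by fastforce
    show ?case
    proof (cases "p < num_accesses P h")
      case True
      with snoc.IH obtain l
        where "l < length h" "P (fst (h ! l))" "num_accesses P (take l h) = p" by blast
      then show ?thesis by (intro exI[of _ l]) (auto simp: nth_append)
    next
      case False
      with snoc.prems x have "P q" "p = num_accesses P h" by (auto split: if_splits)
      then show ?thesis using x by (intro exI[of _ "length h"]) auto
    qed
  qed simp
  then show ?thesis using that by blast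
qed

section \<open>Databases consistent with a history\<close>

text \<open>No algorithm is mentioned: the databases consistent with \<open>h\<close> are those that
  its answers do not rule out, however the accesses were chosen.\<close>

definition consistent :: "'a database \<Rightarrow> 'a history \<Rightarrow> bool" where
  "consistent D h \<longleftrightarrow> (\<forall>l<length h. snd (h ! l) = reply D (take l h) (fst (h ! l)))"

lemma consistent_snoc: "consistent D (h @ [(q, a)]) \<longleftrightarrow> consistent D h \<and> a = reply D h q"
  unfolding consistent_def by (auto simp: nth_append less_Suc_eq)

lemma consistent_run: "consistent D (run A D n)"
proof (induction n)
  case (Suc n)
  then show ?case by (auto simp: Let_def consistent_snoc split: step.splits)
qed (simp add: consistent_def)

lemma consistent_sorted_eq:
  assumes "consistent D h" "consistent D' h" "p < num_accesses (\<lambda>q. q = Sorted i) h"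
    and "i < length D" "i < length D'"
  shows "(if p < length (D ! i) then Some (D ! i ! p) else None) =
         (if p < length (D' ! i) then Some (D' ! i ! p) else None)"
proof -
  obtain l where l: "l < length h" "fst (h ! l) = Sorted i"
    "num_accesses (\<lambda>q. q = Sorted i) (take l h) = p"
    using num_accesses_nth_occurrence[OF assms(3)] by blast
  with assms(1,2) have "reply D (take l h) (Sorted i) = reply D' (take l h) (Sorted i)"
    unfolding consistent_def by metis
  with l assms(4,5) show ?thesis by (simp add: Let_def split: if_splits)
qed

lemma consistent_random_eq:
  assumes "consistent D h" "consistent D' h" "Random R i \<in> fst ` set h"
    and "i < length D" "i < length D'"
  shows "map_of (D ! i) R = map_of (D' ! i) R"
proof -
  obtain l where l: "l < length h" "fst (h ! l) = Random R i"
    using assms(3) by (auto simp: in_set_conv_nth)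
  with assms(1,2) have "reply D (take l h) (Random R i) = reply D' (take l h) (Random R i)"
    unfolding consistent_def by metis
  with assms(4,5) show ?thesis by simp
qed

text \<open>Reading a list once more than its length yields all entries and then
  \<open>None\<close>, which fixes the length too; hence the strict inequality in
  \<open>exh\<close>.\<close>

lemma consistent_exhausted_eq:
  assumes "consistent D h" "consistent D' h" "length D = m" "length D' = m"
    and exh: "\<And>i. i < m \<Longrightarrow> length (D ! i) < num_accesses (\<lambda>q. q = Sorted i) h"
  shows "D' = D"
proof (rule nth_equalityI)
  fix i assume "i < length D'"
  then have i: "i < m" using assms by simp
  have eq: "(if p < length (D ! i) then Some (D ! i ! p) else None) =
         (if p < length (D' ! i) then Some (D' ! i ! p) else None)" if "p \<le> length (D ! i)" for p
    using consistent_sorted_eq[OF assms(1,2), of p i] exh[OF i] that i assms(3,4) by simp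
  have "length (D' ! i) \<le> length (D ! i)"
    using eq[of "length (D ! i)"] by (simp split: if_splits)
  moreover have "length (D ! i) \<le> length (D' ! i)"
  proof (rule ccontr)
    assume "\<not> ?thesis"
    with eq[of "length (D' ! i)"] show False by simp
  qed
  ultimately have len: "length (D' ! i) = length (D ! i)" by simp
  show "D' ! i = D ! i"
  proof (rule nth_equalityI)
    fix p assume "p < length (D' ! i)"
    with eq[of p] len show "D' ! i ! p = D ! i ! p" by simp
  qed (fact len)
qed (use assms in simp)

section \<open>Runs, halting and lower bounds on the cost\<close>

lemma run_mono: "n \<le> n' \<Longrightarrow> \<exists>ys. run A D n' = run A D n @ ys"
proof (induction n' rule: dec_induct)
  case (step n')
  then show ?case by (auto simp: Let_def split: step.splits)
qed simp

lemma run_after_halt: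
  assumes "halts_after A D n X" "n \<le> n'"
  shows "run A D n' = run A D n"
  using assms(2,1) by (induction n' rule: dec_induct) (auto simp: halts_after_def)

lemma length_run: "length (run A D n) \<le> n"
  by (induction n) (auto simp: Let_def split: step.splits)

lemma length_run_not_halted:
  "(\<And>X. \<not> halts_after A D n X) \<Longrightarrow> length (run A D n) = n"
proof (induction n)
  case (Suc n)
  have "\<not> halts_after A D n X" for X
    using run_after_halt[of A D n X "Suc n"] Suc.prems[of X] by (auto simp: halts_after_def)
  then show ?case using Suc.IH by (auto simp: Let_def halts_after_def split: step.splits)
qed simp

lemma halts_after_final:
  assumes "halts_after A D n X"
  obtains l X' where "l \<le> n" "halts_after A D l X'" "final_history A D = run A D l"
proof -
  let ?P = "\<lambda>n. \<exists>X. halts_after A D n X"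
  have "?P n" using assms by blast
  then have "?P (LEAST n. ?P n)" "(LEAST n. ?P n) \<le> n"
    using LeastI[of ?P n] Least_le[of ?P n] by simp_all
  then show ?thesis using that unfolding final_history_def by blast
qed

lemma num_accesses_run_le_final:
  assumes "halts_after A D n0 X"
  shows "num_accesses P (run A D n) \<le> num_accesses P (final_history A D)"
proof -
  obtain l X' where l: "halts_after A D l X'" "final_history A D = run A D l"
    using halts_after_final[OF assms] by blast
  show ?thesis
  proof (cases "n \<le> l")
    case True
    then show ?thesis using run_mono[of n l A D] l by auto
  next
    case False
    then show ?thesis using run_after_halt[OF l(1), of n] l by simp
  qed
qed

text \<open>Accesses made at any stage of the run stay in the final history. This bound serves when
  many random accesses are forced, \<open>cost_ge_length\<close> when a long run is.\<close>

lemma cost_ge_random: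
  assumes "halts_after A D n0 X" "0 \<le> cS" "0 \<le> cR"
  shows "real (num_accesses (\<lambda>q. \<exists>R i. q = Random R i) (run A D n)) * cR \<le> cost cS cR A D"
proof -
  have "real (num_accesses (\<lambda>q. \<exists>R i. q = Random R i) (run A D n)) * cR
      \<le> real (num_accesses (\<lambda>q. \<exists>R i. q = Random R i) (final_history A D)) * cR"
    using num_accesses_run_le_final[OF assms(1)] assms(3) by (intro mult_right_mono) simp_all
  moreover have "0 \<le> real (num_accesses (\<lambda>q. \<exists>i. q = Sorted i) (final_history A D)) * cS"
    using assms(2) by simp
  ultimately show ?thesis unfolding cost_def by linarith
qed

lemma cost_ge_length:
  assumes "halts_after A D n0 X" "0 \<le> cS" "0 \<le> cR"
  shows "real (length (run A D n)) * min cS cR \<le> cost cS cR A D"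
proof -
  let ?s = "num_accesses (\<lambda>q. \<exists>i. q = Sorted i)"
  let ?r = "num_accesses (\<lambda>q. \<exists>R i. q = Random R i)"
  let ?h = "run A D n" and ?f = "final_history A D"
  have "real (length ?h) * min cS cR = real (?s ?h) * min cS cR + real (?r ?h) * min cS cR"
    by (simp flip: num_accesses_Sorted_plus_Random[of ?h] add: distrib_right)
  also have "\<dots> \<le> real (?s ?f) * cS + real (?r ?f) * cR"
    using assms num_accesses_run_le_final[OF assms(1)] by (intro add_mono mult_mono) simp_all
  finally show ?thesis unfolding cost_def .
qed

section \<open>Algorithms that halt as soon as the answer is determined\<close>

definition determined ::
    "(real list \<Rightarrow> real) \<Rightarrow> nat \<Rightarrow> 'a database set \<Rightarrow> 'a history \<Rightarrow> 'a set \<Rightarrow> bool" where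
  "determined t k \<D> h X \<longleftrightarrow> (\<forall>D\<in>\<D>. consistent D h \<longrightarrow> top_k t k D X)"

text \<open>After \<open>Q\<close> the lists are read in turn, which guarantees halting on databases
  for which \<open>Q\<close> settles nothing.\<close>

definition schedule :: "nat \<Rightarrow> 'a access list \<Rightarrow> nat \<Rightarrow> 'a access" where
  "schedule m Q l = (if l < length Q then Q ! l else Sorted (l mod m))"

text \<open>Internal computation is free, so the halting test may range over all databases of the
  class. Correctness then holds for every \<open>Q\<close> (see \<open>certifying_correct\<close>),
  and \<open>Q\<close> only governs the cost.\<close>

definition certifying ::
    "(real list \<Rightarrow> real) \<Rightarrow> nat \<Rightarrow> 'a database set \<Rightarrow> nat \<Rightarrow> 'a access list \<Rightarrow> 'a algorithm" where
  "certifying t k \<D> m Q h =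
     (if \<exists>X. determined t k \<D> h X then Halt (SOME X. determined t k \<D> h X)
      else Access (schedule m Q (length h)))"

lemma halts_certifying_iff:
  "(\<exists>X. halts_after (certifying t k \<D> m Q) D n X) \<longleftrightarrow>
   (\<exists>X. determined t k \<D> (run (certifying t k \<D> m Q) D n) X)"
  by (simp add: halts_after_def certifying_def)

lemma queries_certifying:
  obtains n' where "n' \<le> n"
    "map fst (run (certifying t k \<D> m Q) D n) = map (schedule m Q) [0..<n']"
    "(\<And>X. \<not> halts_after (certifying t k \<D> m Q) D n X) \<Longrightarrow> n' = n"
proof -
  let ?A = "certifying t k \<D> m Q"
  have "\<exists>n'\<le>n. map fst (run ?A D n) = map (schedule m Q) [0..<n']"
  proof (induction n)
    case (Suc n)
    then obtain n' where n': "n' \<le> n" "map fst (run ?A D n) = map (schedule m Q) [0..<n']"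
      by blast
    show ?case
    proof (cases "?A (run ?A D n)")
      case (Access q)
      then have "q = schedule m Q n'"
        using arg_cong[OF n'(2), of length] by (auto simp: certifying_def split: if_splits)
      with Access n' show ?thesis by (intro exI[of _ "Suc n'"]) (simp add: Let_def)
    next
      case (Halt X)
      with n' show ?thesis by (intro exI[of _ n']) (simp add: Let_def)
    qed
  qed simp
  then obtain n' where n': "n' \<le> n" "map fst (run ?A D n) = map (schedule m Q) [0..<n']" by blast
  have "n' = n" if "\<And>X. \<not> halts_after ?A D n X"
    using length_run_not_halted[OF that] arg_cong[OF n'(2), of length] by simp
  with n' show ?thesis using that by blast
qed

lemma schedule_exhausts:
  assumes "i < m"
  shows "\<exists>n. \<forall>n'\<ge>n. K < length (filter (\<lambda>q. q = Sorted i) (map (schedule m Q) [0..<n']))"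
proof -
  \<comment> \<open>These indices are congruent to \<open>i\<close> modulo \<open>m\<close> and lie
    beyond \<open>Q\<close>, so each of them is a sorted access to list \<open>i\<close>.\<close>
  let ?g = "\<lambda>r. (length Q + r) * m + i"
  have "K < length (filter (\<lambda>q. q = Sorted i) (map (schedule m Q) [0..<n']))"
    if n': "n' \<ge> (length Q + Suc K) * m" for n'
  proof -
    have sub: "?g ` {..K} \<subseteq> {l. l < n' \<and> schedule m Q l = Sorted i}"
    proof safe
      fix r assume r: "r \<le> K"
      have "?g r < (length Q + Suc r) * m" using assms by (simp add: algebra_simps)
      also have "\<dots> \<le> (length Q + Suc K) * m" using r by (intro mult_right_mono) auto
      finally show "?g r < n'" using n' by simp
      have "length Q * 1 \<le> (length Q + r) * m" using assms by (intro mult_mono) auto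
      then show "schedule m Q (?g r) = Sorted i" using assms by (simp add: schedule_def)
    qed
    have inj: "inj_on ?g {..K}" using assms by (auto simp: inj_on_def)
    have "Suc K = card (?g ` {..K})" using card_image[OF inj] by simp
    also have "\<dots> \<le> card {l. l < n' \<and> schedule m Q l = Sorted i}"
      by (intro card_mono sub) simp
    also have "{l. l < n' \<and> schedule m Q l = Sorted i}
        = set (filter (\<lambda>l. schedule m Q l = Sorted i) [0..<n'])" by auto
    also have "card \<dots> = length (filter (\<lambda>l. schedule m Q l = Sorted i) [0..<n'])"
      by (intro distinct_card) simp
    finally show ?thesis by (simp add: filter_map comp_def)
  qed
  then show ?thesis by blast
qed

text \<open>Without halting, every list would be read past its end, leaving \<open>D\<close> as the
  only consistent database, whose top \<open>k\<close> would then be determined. On halting,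
  \<open>D\<close> itself is consistent with the history, so the output is right for it.\<close>

lemma certifying_correct:
  assumes len: "\<And>D. D \<in> \<D> \<Longrightarrow> length D = m" and ex: "\<And>D. D \<in> \<D> \<Longrightarrow> \<exists>X. top_k t k D X"
  shows "certifying t k \<D> m Q \<in> correct_algorithms t k \<D>"
  unfolding correct_algorithms_def
proof safe
  fix D assume D: "D \<in> \<D>"
  let ?A = "certifying t k \<D> m Q"
  have "\<exists>n X. halts_after ?A D n X"
  proof (rule ccontr)
    assume "\<not> ?thesis"
    then have no: "\<not> halts_after ?A D n X" for n X by blast
    have "\<forall>i\<in>{..<m}. \<exists>n. \<forall>n'\<ge>n. length (D ! i)
        < length (filter (\<lambda>q. q = Sorted i) (map (schedule m Q) [0..<n']))"
      using schedule_exhausts by blast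
    then obtain N where N: "\<And>i n'. i < m \<Longrightarrow> N i \<le> n' \<Longrightarrow> length (D ! i)
        < length (filter (\<lambda>q. q = Sorted i) (map (schedule m Q) [0..<n']))"
      by (metis lessThan_iff)
    define n where "n = (\<Sum>i<m. N i)"
    have Nn: "N i \<le> n" if "i < m" for i
      unfolding n_def using that by (intro member_le_sum) auto
    have queries: "map fst (run ?A D n) = map (schedule m Q) [0..<n]"
      using queries_certifying[of n t k \<D> m Q D] no by metis
    have exh: "length (D ! i) < num_accesses (\<lambda>q. q = Sorted i) (run ?A D n)" if "i < m" for i
      unfolding num_accesses_conv_filter queries using N[OF that Nn[OF that]] .
    obtain X where X: "top_k t k D X" using ex[OF D] by blast
    have "determined t k \<D> (run ?A D n) X"
      unfolding determined_def
    proof safe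
      fix D' assume "D' \<in> \<D>" "consistent D' (run ?A D n)"
      then have "D' = D"
        using consistent_exhausted_eq[OF consistent_run[of D ?A n] _ len[OF D] len exh] by blast
      with X show "top_k t k D' X" by simp
    qed
    then show False using no halts_certifying_iff by blast
  qed
  then obtain n X where nX: "halts_after ?A D n X" by blast
  then have ex': "\<exists>X. determined t k \<D> (run ?A D n) X" using halts_certifying_iff by blast
  then have "determined t k \<D> (run ?A D n) X"
    using nX someI_ex[OF ex'] by (simp add: halts_after_def certifying_def)
  then have "top_k t k D X" using D consistent_run unfolding determined_def by blast
  with nX show "\<exists>n X. halts_after ?A D n X \<and> top_k t k D X" by blast
qed

text \<open>Once all of \<open>Q\<close> has been asked the answer is determined, so the run stops
  there at the latest and its accesses form a prefix of \<open>Q\<close>.\<close>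

lemma cost_certifying_le:
  assumes det: "\<And>h. consistent D h \<Longrightarrow> map fst h = Q \<Longrightarrow> determined t k \<D> h X"
    and nonneg: "0 \<le> cS" "0 \<le> cR"
  shows "cost cS cR (certifying t k \<D> m Q) D \<le>
    real (length (filter (\<lambda>q. \<exists>i. q = Sorted i) Q)) * cS +
    real (length (filter (\<lambda>q. \<exists>R i. q = Random R i) Q)) * cR"
proof -
  let ?A = "certifying t k \<D> m Q"
  have sched: "map (schedule m Q) [0..<n] = take n Q" if "n \<le> length Q" for n
    using that by (intro nth_equalityI) (auto simp: schedule_def)
  have "\<exists>X. halts_after ?A D (length Q) X"
  proof (rule ccontr)
    assume no: "\<not> ?thesis"
    then have "map fst (run ?A D (length Q)) = Q"
      using queries_certifying[of "length Q" t k \<D> m Q D] sched[of "length Q"] by fastforce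
    then show False using det[OF consistent_run] no halts_certifying_iff by blast
  qed
  then obtain l where l: "l \<le> length Q" "final_history ?A D = run ?A D l"
    using halts_after_final by metis
  obtain n' where n': "n' \<le> l" "map fst (run ?A D l) = map (schedule m Q) [0..<n']"
    using queries_certifying[of l t k \<D> m Q D] by metis
  then have take: "map fst (run ?A D l) = take n' Q" using sched l by simp
  have "num_accesses P (final_history ?A D) \<le> length (filter P Q)" for P
  proof -
    have "length (filter P Q) = length (filter P (take n' Q)) + length (filter P (drop n' Q))"
      by (simp flip: length_append filter_append)
    then show ?thesis unfolding num_accesses_conv_filter l(2) take by simp
  qed
  then show ?thesis unfolding cost_def using nonneg by (intro add_mono mult_right_mono) simp_all
qed

section \<open>The adversary's databases\<close>

lemma distinct_if_sorted_wrt: "sorted_wrt R xs \<Longrightarrow> (\<And>x. \<not> R x x) \<Longrightarrow> distinct xs"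
  by (induction xs) auto

lemma min_agg_map_upt:
  assumes "2 \<le> m"
  shows "min_agg (map g [0..<m]) = Min (insert (g 0 + g 1) (g ` {2..<m}))"
proof -
  have "drop 2 (map g [0..<m]) = map g [2..<m]" by (simp add: drop_map numeral_2_eq_2)
  then show ?thesis using assms by (simp add: min_agg_def)
qed

lemma grades_conv_upt:
  "length D = m \<Longrightarrow> grades D R = map (\<lambda>i. the (map_of (D ! i) R)) [0..<m]"
  unfolding grades_def by (auto intro: nth_equalityI)

text \<open>
  The objects \<open>f j\<close> with \<open>j < n\<close> are the candidates: they occupy the first \<open>n\<close> places of the lists
  0 and 1, in opposite orders, and their first two grades add up to 1/2. The remaining \<open>M\<close>
  objects occupy the first \<open>M\<close> places of all other lists. The pair \<open>(j, i) \<in> S\<close>, where \<open>i \<ge> 2\<close>,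
  makes the grade of candidate \<open>j\<close> in list \<open>i\<close> smaller than 1/2.
\<close>

locale adversary =
  fixes f :: "nat \<Rightarrow> 'a" and m k n M :: nat
  assumes inj: "inj f" and m: "3 \<le> m" and k: "1 \<le> k" and kn: "k \<le> n" and M: "1 \<le> M"
begin

text \<open>Increasing perturbations that make the grades within a list distinct; the denominator
  keeps them below 1/8 for all objects in use.\<close>

definition eps :: "nat \<Rightarrow> real" where
  "eps j = real j / (8 * real (n + M))"

text \<open>The perturbations of a candidate cancel in the sum of its first two grades. These grades
  lie in (1/4, 3/8] and [1/8, 1/4), those of the other objects below 1/8. In later lists the other
  objects lie above 7/8, high candidates in (5/8, 3/4], low ones in (1/4, 3/8].\<close>

definition field_grade :: "(nat \<times> nat) set \<Rightarrow> nat \<Rightarrow> nat \<Rightarrow> real" where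
  "field_grade S i j =
     (if j < n then
        if i = 0 then 3/8 - eps j
        else if i = 1 then 1/8 + eps j
        else if (j, i) \<in> S then 3/8 - eps j
        else 3/4 - eps j
      else if i < 2 then 1/8 - eps j
      else 1 - eps j)"

definition ranking :: "(nat \<times> nat) set \<Rightarrow> nat \<Rightarrow> nat list" where
  "ranking S i =
     (if i = 0 then [0..<n] @ [n..<n+M]
      else if i = 1 then rev [0..<n] @ [n..<n+M]
      else [n..<n+M] @ filter (\<lambda>j. (j, i) \<notin> S) [0..<n] @ filter (\<lambda>j. (j, i) \<in> S) [0..<n])"

definition db :: "(nat \<times> nat) set \<Rightarrow> 'a database" where
  "db S = map (\<lambda>i. map (\<lambda>j. (f j, field_grade S i j)) (ranking S i)) [0..<m]"

lemma eps_less: "i < j \<Longrightarrow> eps i < eps j"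
  using M by (simp add: eps_def divide_strict_right_mono)

lemma eps_nonneg: "0 \<le> eps j"
  by (simp add: eps_def)

lemma eps_bound: "j < n + M \<Longrightarrow> eps j < 1/8"
  by (simp add: eps_def field_simps)

text \<open>Candidate 0 has grade exactly 1/8 in list 1, so the objects ranked after it there must
  lie strictly below.\<close>

lemma eps_pos: "n \<le> j \<Longrightarrow> 0 < eps j"
  using k kn M by (simp add: eps_def)

lemma set_ranking: "set (ranking S i) = {0..<n+M}"
  by (auto simp: ranking_def)

lemma length_ranking: "length (ranking S i) = n + M"
proof -
  have "length (filter (\<lambda>j. (j, i) \<notin> S) [0..<n]) + length (filter (\<lambda>j. (j, i) \<in> S) [0..<n]) = n"
    using sum_length_filter_compl[of "\<lambda>j. (j, i) \<in> S" "[0..<n]"] by simp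
  then show ?thesis by (simp add: ranking_def)
qed

text \<open>Within a block of \<open>ranking\<close> the perturbations decide; different blocks have
  grades in disjoint intervals.\<close>

lemma sorted_ranking:
  "sorted_wrt (\<lambda>a b. field_grade S i b < field_grade S i a) (ranking S i)"
proof -
  have up: "sorted_wrt (\<lambda>a b. eps a < eps b) [a..<b]" for a b
    using eps_less by (auto intro: sorted_wrt_mono_rel[OF _ sorted_wrt_upt])
  have cmp: "eps j < 1/8" "0 \<le> eps j" if "j < n + M" for j
    using eps_bound[OF that] eps_nonneg[of j] by auto
  have cand: "j < n \<Longrightarrow> eps j < 1/8" for j using cmp[of j] by simp
  have nn: "0 \<le> eps j" for j by (rule eps_nonneg)
  have fil: "sorted_wrt (\<lambda>a b. eps a < eps b) (filter P [0..<n])" for P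
    using up by (rule sorted_wrt_filter)
  have pos: "n \<le> j \<Longrightarrow> 0 < eps j" for j by (rule eps_pos)
  consider "i = 0" | "i = 1" | "2 \<le> i" by linarith
  then show ?thesis
  proof cases
    case 1
    have A: "sorted_wrt (\<lambda>a b. field_grade S i b < field_grade S i a) [0..<n]"
      by (rule sorted_wrt_mono_rel[OF _ up]) (auto simp: field_grade_def 1)
    have B: "sorted_wrt (\<lambda>a b. field_grade S i b < field_grade S i a) [n..<n+M]"
      by (rule sorted_wrt_mono_rel[OF _ up]) (auto simp: field_grade_def 1)
    have "field_grade S i b < field_grade S i a" if "a < n" "n \<le> b" "b < n + M" for a b
      using that cand[of a] nn[of b] by (simp add: field_grade_def 1)
    with A B show ?thesis by (auto simp: ranking_def sorted_wrt_append 1)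
  next
    case 2
    have A: "sorted_wrt (\<lambda>a b. field_grade S i b < field_grade S i a) (rev [0..<n])"
      unfolding sorted_wrt_rev
      by (rule sorted_wrt_mono_rel[OF _ up]) (auto simp: field_grade_def 2)
    have B: "sorted_wrt (\<lambda>a b. field_grade S i b < field_grade S i a) [n..<n+M]"
      by (rule sorted_wrt_mono_rel[OF _ up]) (auto simp: field_grade_def 2)
    have "field_grade S i b < field_grade S i a" if "a < n" "n \<le> b" "b < n + M" for a b
      using that nn[of a] pos[of b] by (simp add: field_grade_def 2)
    with A B show ?thesis by (auto simp: ranking_def sorted_wrt_append 2)
  next
    case 3
    have A: "sorted_wrt (\<lambda>a b. field_grade S i b < field_grade S i a) [n..<n+M]"
      by (rule sorted_wrt_mono_rel[OF _ up]) (use 3 in \<open>auto simp: field_grade_def\<close>)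
    have B: "sorted_wrt (\<lambda>a b. field_grade S i b < field_grade S i a)
        (filter (\<lambda>j. (j, i) \<notin> S) [0..<n])"
      by (rule sorted_wrt_mono_rel[OF _ fil]) (use 3 in \<open>auto simp: field_grade_def\<close>)
    have C: "sorted_wrt (\<lambda>a b. field_grade S i b < field_grade S i a)
        (filter (\<lambda>j. (j, i) \<in> S) [0..<n])"
      by (rule sorted_wrt_mono_rel[OF _ fil]) (use 3 in \<open>auto simp: field_grade_def\<close>)
    have AB: "field_grade S i b < field_grade S i a" if "n \<le> a" "a < n + M" "b < n" for a b
      using that 3 cmp(1)[of a] nn[of b] by (simp add: field_grade_def)
    have BC: "field_grade S i b < field_grade S i a"
      if "a < n" "b < n" "(a, i) \<notin> S" "(b, i) \<in> S" for a b
      using that 3 cand[of a] nn[of b] by (simp add: field_grade_def)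
    from A B C AB BC 3 show ?thesis
      by (auto simp: ranking_def sorted_wrt_append)
  qed
qed

lemma distinct_ranking: "distinct (ranking S i)"
  using sorted_ranking[of S i] by (rule distinct_if_sorted_wrt) simp

lemma length_db [simp]: "length (db S) = m"
  by (simp add: db_def)

lemma nth_db: "i < m \<Longrightarrow> db S ! i = map (\<lambda>j. (f j, field_grade S i j)) (ranking S i)"
  by (simp add: db_def)

lemma inj_on_f: "inj_on f A"
  using inj by (rule inj_on_subset) simp

lemma map_of_db:
  assumes "i < m" "j < n + M"
  shows "map_of (db S ! i) (f j) = Some (field_grade S i j)"
proof -
  have "(f j, field_grade S i j) \<in> set (db S ! i)"
    using assms set_ranking[of S i] by (auto simp: nth_db)
  moreover have "distinct (map fst (db S ! i))"
    using assms distinct_ranking[of S i] by (simp add: nth_db comp_def distinct_map inj_on_f)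
  ultimately show ?thesis by (rule map_of_is_SomeI[rotated])
qed

lemma map_of_db_None:
  assumes "i < m" "R \<notin> f ` {0..<n+M}"
  shows "map_of (db S ! i) R = None"
  using assms set_ranking[of S i] by (auto simp: nth_db map_of_eq_None_iff)

lemma objects_db: "objects (db S) = f ` {0..<n+M}"
proof -
  have "fst ` set (map (\<lambda>j. (f j, field_grade S i j)) (ranking S i)) = f ` {0..<n+M}" for i
    using set_ranking[of S i] by (simp add: image_image)
  moreover have "{0..<m} \<noteq> {}" using m by simp
  ultimately show ?thesis unfolding objects_def db_def by auto
qed

lemma field_grade_range:
  assumes "j < n + M"
  shows "0 \<le> field_grade S i j \<and> field_grade S i j \<le> 1"
  using eps_nonneg[of j] eps_bound[OF assms] by (auto simp: field_grade_def)

lemma db_in_distinct_databases: "db S \<in> distinct_databases m k"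
proof -
  have card: "k \<le> card (f ` {0..<n+M})" using kn by (simp add: card_image inj_on_f)
  have L: "distinct (map fst L) \<and> fst ` set L = objects (db S) \<and>
        snd ` set L \<subseteq> {0..1} \<and> sorted_wrt (\<ge>) (map snd L) \<and> distinct (map snd L)"
    if "L \<in> set (db S)" for L
  proof -
    obtain i where L: "L = map (\<lambda>j. (f j, field_grade S i j)) (ranking S i)"
      using \<open>L \<in> set (db S)\<close> by (auto simp: db_def)
    have "sorted_wrt (\<lambda>x y. y < x) (map snd L)"
      using sorted_ranking[of S i] by (simp add: L sorted_wrt_map)
    then have "sorted_wrt (\<ge>) (map snd L)" "distinct (map snd L)"
      by (auto intro: sorted_wrt_mono_rel[of _ "\<lambda>x y. y < x"] distinct_if_sorted_wrt)
    moreover have "distinct (map fst L)"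
      using distinct_ranking[of S i] by (simp add: L comp_def distinct_map inj_on_f)
    moreover have "fst ` set L = objects (db S)"
      using set_ranking[of S i] by (simp add: L objects_db image_image)
    moreover have "snd ` set L \<subseteq> {0..1}"
      using field_grade_range set_ranking[of S i] by (auto simp: L)
    ultimately show ?thesis by blast
  qed
  with card show ?thesis
    unfolding distinct_databases_def is_database_def distinctness_def by (simp add: objects_db)
qed

section \<open>Overall grades and the unique top \<open>k\<close>\<close>

lemma grades_db: "j < n + M \<Longrightarrow> grades (db S) (f j) = map (\<lambda>i. field_grade S i j) [0..<m]"
  by (subst grades_conv_upt[where m = m]) (auto simp: map_of_db)

lemma min_agg_db:
  "j < n + M \<Longrightarrow> min_agg (grades (db S) (f j)) =
    Min (insert (field_grade S 0 j + field_grade S 1 j) ((\<lambda>i. field_grade S i j) ` {2..<m}))"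
  using m by (simp add: grades_db min_agg_map_upt)

lemma min_agg_high:
  assumes "j < n" "j \<notin> fst ` S"
  shows "min_agg (grades (db S) (f j)) = 1/2"
proof -
  have "field_grade S 0 j + field_grade S 1 j = 1/2"
    using assms by (simp add: field_grade_def)
  moreover have "1/2 \<le> field_grade S i j" if "2 \<le> i" for i
  proof -
    have "(j, i) \<notin> S" using assms(2) by force
    then show ?thesis using that assms(1) eps_bound[of j] by (simp add: field_grade_def)
  qed
  moreover have "j < n + M" using assms(1) by simp
  ultimately show ?thesis
    unfolding min_agg_db[OF \<open>j < n + M\<close>] by (intro Min_eqI) auto
qed

lemma min_agg_low:
  assumes "(j, i) \<in> S" "2 \<le> i" "i < m" "j < n"
  shows "min_agg (grades (db S) (f j)) < 1/2"
proof -
  have "min_agg (grades (db S) (f j)) \<le> field_grade S i j"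
    using assms by (subst min_agg_db) (simp, intro Min_le, auto)
  also have "\<dots> < 1/2" using assms eps_nonneg[of j] by (simp add: field_grade_def)
  finally show ?thesis .
qed

lemma min_agg_other:
  assumes "n \<le> j" "j < n + M"
  shows "min_agg (grades (db S) (f j)) < 1/2"
proof -
  have "min_agg (grades (db S) (f j)) \<le> field_grade S 0 j + field_grade S 1 j"
    using assms by (subst min_agg_db) (simp, intro Min_le, auto)
  also have "\<dots> < 1/2" using assms eps_nonneg[of j] by (simp add: field_grade_def)
  finally show ?thesis .
qed

text \<open>The candidates below \<open>k - 1\<close> fill up the top \<open>k\<close>; only the last place is contested.\<close>

definition winners :: "nat \<Rightarrow> nat set" where
  "winners R = insert R {..<k - 1}"

lemma card_winners: "k - 1 \<le> R \<Longrightarrow> card (f ` winners R) = k"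
proof -
  assume "k - 1 \<le> R"
  then have "card (winners R) = k" using k by (simp add: winners_def)
  then show ?thesis by (simp add: card_image inj_on_f)
qed

text \<open>The candidates in \<open>winners R\<close> avoid \<open>S\<close> and have overall grade
  1/2, while all other objects have less, so no tie offers a second choice.\<close>

lemma top_k_unique:
  assumes S: "S \<subseteq> {k - 1..<n} \<times> {2..<m}" "fst ` S = {k - 1..<n} - {R}"
    and R: "R \<in> {k - 1..<n}" and top: "top_k min_agg k (db S) X"
  shows "X = f ` winners R"
proof (rule ccontr)
  assume neq: "X \<noteq> f ` winners R"
  have X: "X \<subseteq> f ` {0..<n+M}" "card X = k"
    using top by (auto simp: top_k_def objects_db)
  have fin: "finite X" using X(1) finite_subset by blast
  have "finite (f ` winners R)" by (simp add: winners_def)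
  \<comment> \<open>Different finite sets of the same size \<open>k\<close> do not contain each
    other, so some winner is missing from \<open>X\<close> and some loser is in it.\<close>
  then have "\<not> f ` winners R \<subseteq> X" "\<not> X \<subseteq> f ` winners R"
    using neq X(2) card_winners[of R] R fin by (metis atLeastLessThan_iff card_subset_eq)+
  then obtain w x where w: "w \<in> winners R" "f w \<notin> X" and x: "f x \<in> X" "x \<notin> winners R" "x < n + M"
    using X(1) by (fastforce simp: image_iff subset_iff)
  have "w < n" "w \<notin> fst ` S" using w R kn k S(2) by (auto simp: winners_def)
  then have "min_agg (grades (db S) (f w)) = 1/2" by (rule min_agg_high)
  moreover have "min_agg (grades (db S) (f x)) < 1/2"
  proof (cases "x < n")
    case True
    then have "x \<in> fst ` S" using x S(2) by (auto simp: winners_def)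
    then obtain i where "(x, i) \<in> S" by auto
    then show ?thesis using S(1) True by (intro min_agg_low[of x i]) auto
  qed (use x min_agg_other in simp)
  moreover have "min_agg (grades (db S) (f w)) \<le> min_agg (grades (db S) (f x))"
    using top w x \<open>w < n\<close> by (auto simp: top_k_def objects_db)
  ultimately show False by simp
qed

subsection \<open>A short certificate\<close>

text \<open>The reading goes to \<open>n + 1\<close> entries, not \<open>n\<close>: the entry after
  the candidates has a grade below 1/8, which bounds all unread grades of that list.\<close>

definition certificate :: "nat \<Rightarrow> 'a access list" where
  "certificate R = replicate (n + 1) (Sorted 0) @ replicate (n + 1) (Sorted 1) @
     concat (map (\<lambda>j. map (Random (f j)) [0..<m]) (R # [0..<k - 1]))"

lemma length_filter_certificate:
  "length (filter (\<lambda>q. \<exists>i. q = Sorted i) (certificate R)) = 2 * (n + 1)"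
  "length (filter (\<lambda>q. \<exists>R i. q = Random R i) (certificate R)) = k * m"
proof -
  have *: "length (filter (\<lambda>q. \<exists>i. q = Sorted i) (concat (map (\<lambda>j. map (Random (f j)) [0..<m]) js))) = 0"
    "length (filter (\<lambda>q. \<exists>R i. q = Random R i) (concat (map (\<lambda>j. map (Random (f j)) [0..<m]) js)))
      = length js * m" for js
    by (induction js) (simp_all add: filter_map comp_def)
  show "length (filter (\<lambda>q. \<exists>i. q = Sorted i) (certificate R)) = 2 * (n + 1)"
    using *(1)[of "R # [0..<k - 1]"] unfolding certificate_def by simp
  show "length (filter (\<lambda>q. \<exists>R i. q = Random R i) (certificate R)) = k * m"
    using *(2)[of "R # [0..<k - 1]"] k unfolding certificate_def by (simp add: algebra_simps)
qed

text \<open>Places below \<open>n\<close> hold candidates with their known grades; from place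
  \<open>n\<close> on, the descending order bounds every grade by that of entry \<open>n\<close>.
  The further objects of \<open>D\<close> may be arbitrary.\<close>

lemma first_two_grades:
  assumes D: "D \<in> distinct_databases m k" and i: "i < 2" and x: "(Z, x) \<in> set (D ! i)"
    and agree: "\<And>p. p \<le> n \<Longrightarrow> p < length (D ! i) \<and> D ! i ! p = db S ! i ! p"
  shows "x < 1/8 \<or> (\<exists>j<n. Z = f j \<and> x = field_grade S i j)"
proof -
  obtain p where p: "p < length (D ! i)" "D ! i ! p = (Z, x)"
    using x by (auto simp: in_set_conv_nth)
  have im: "i < m" using i m by simp
  have rn: "ranking S i ! n = n" using i M by (auto simp: ranking_def nth_append)
  have zn: "snd (D ! i ! n) < 1/8"
    using agree[of n] i im rn M eps_pos[of n]
    by (simp add: nth_db length_ranking field_grade_def)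
  show ?thesis
  proof (cases "p < n")
    case True
    have "ranking S i ! p < n" using i True by (auto simp: ranking_def nth_append rev_nth)
    then show ?thesis using agree[of p] p True im by (auto simp: nth_db length_ranking)
  next
    case False
    have "D ! i \<in> set D"
      using D im by (auto simp: distinct_databases_def is_database_def)
    then have "sorted_wrt (\<ge>) (map snd (D ! i))"
      using D by (auto simp: distinct_databases_def is_database_def)
    then have "snd (D ! i ! p) \<le> snd (D ! i ! n)"
      using False p sorted_wrt_nth_less[of "(\<ge>)" "map snd (D ! i)" n p]
      by (cases "p = n") auto
    then show ?thesis using zn p by simp
  qed
qed

text \<open>In every consistent database the random accesses fix the overall grade 1/2 of the
  winners, and the sorted accesses bound the sum of the first two grades of any object by 1/2. Ties
  at 1/2 are harmless.\<close>

lemma certificate_determines: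
  assumes S: "S \<subseteq> {k - 1..<n} \<times> {2..<m}" "fst ` S = {k - 1..<n} - {R}" and R: "R \<in> {k - 1..<n}"
    and h: "consistent (db S) h" "map fst h = certificate R"
  shows "determined min_agg k (distinct_databases m k) h (f ` winners R)"
  unfolding determined_def
proof safe
  fix D assume D: "D \<in> distinct_databases m k" "consistent D h"
  have lenD: "length D = m" using D by (auto simp: distinct_databases_def is_database_def)
  have fsts: "\<And>L. L \<in> set D \<Longrightarrow> fst ` set L = objects D" and
    dist: "\<And>L. L \<in> set D \<Longrightarrow> distinct (map fst L)"
    using D by (auto simp: distinct_databases_def is_database_def)
  have agree: "p < length (D ! i) \<and> D ! i ! p = db S ! i ! p" if "i < 2" "p \<le> n" for i p
  proof -
    have "p < num_accesses (\<lambda>q. q = Sorted i) h"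
      unfolding num_accesses_conv_filter h(2) certificate_def using that by (cases "i = 0") auto
    from consistent_sorted_eq[OF h(1) D(2) this]
    show ?thesis using that m M lenD by (simp add: nth_db length_ranking split: if_splits)
  qed
  have mof: "map_of (D ! i) (f j) = Some (field_grade S i j)" if "j \<in> winners R" "i < m" for i j
  proof -
    have "Random (f j) i \<in> set (certificate R)"
      using that unfolding certificate_def winners_def by fastforce
    then have "Random (f j) i \<in> fst ` set h" by (simp flip: h(2))
    moreover have "j < n + M" using that R k kn by (auto simp: winners_def)
    ultimately show ?thesis
      using consistent_random_eq[OF h(1) D(2), of "f j" i] map_of_db that lenD by simp
  qed
  have sub: "f ` winners R \<subseteq> objects D"
  proof safe
    fix j assume "j \<in> winners R"
    then have "(f j, field_grade S 0 j) \<in> set (D ! 0)" using mof[of j 0] m by (auto dest: map_of_SomeD)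
    moreover have "D ! 0 \<in> set D" using lenD m by simp
    ultimately show "f j \<in> objects D" using fsts by force
  qed
  have win: "min_agg (grades D (f j)) = 1/2" if j: "j \<in> winners R" for j
  proof -
    have jn: "j < n" "j \<notin> fst ` S" using j R k kn S(2) by (auto simp: winners_def)
    have "grades D (f j) = grades (db S) (f j)"
      using jn mof[OF j] by (simp add: grades_db grades_conv_upt[OF lenD])
    then show ?thesis using min_agg_high[OF jn] by simp
  qed
  have others: "min_agg (grades D Z) \<le> 1/2" if Z: "Z \<in> objects D" for Z
  proof -
    let ?g = "\<lambda>i. the (map_of (D ! i) Z)"
    have g: "?g i < 1/8 \<or> (\<exists>j<n. Z = f j \<and> ?g i = field_grade S i j)" if "i < 2" for i
    proof -
      have Di: "D ! i \<in> set D" using lenD m that by simp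
      then have "Z \<in> fst ` set (D ! i)" using fsts Z by blast
      then obtain x where x: "(Z, x) \<in> set (D ! i)" by auto
      then have "?g i = x" using dist[OF Di] by simp
      then show ?thesis using first_two_grades[OF D(1) that x] agree[OF that] by blast
    qed
    have bnd: "eps j < 1/8" "0 \<le> eps j" if "j < n" for j
      using that eps_bound[of j] eps_nonneg[of j] by auto
    have "?g 0 + ?g 1 \<le> 1/2"
    proof -
      \<comment> \<open>Two small grades sum to less than 1/4; a candidate grade of at most 3/8
        joins a small one below 1/8; two candidate grades belong to the same candidate and sum to
        exactly 1/2.\<close>
      consider "?g 0 < 1/8" "?g 1 < 1/8"
        | j where "?g 0 < 1/8" "j < n" "?g 1 = field_grade S 1 j"
        | j where "?g 1 < 1/8" "j < n" "?g 0 = field_grade S 0 j"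
        | j j' where "j < n" "j' < n" "f j = f j'" "?g 0 = field_grade S 0 j" "?g 1 = field_grade S 1 j'"
        using g[of 0] g[of 1] by auto
      then show ?thesis
      proof cases
        case (4 j j')
        then have "j = j'" using inj by (simp add: inj_eq)
        with 4 show ?thesis by (simp add: field_grade_def)
      qed (use bnd in \<open>force simp: field_grade_def\<close>)+
    qed
    moreover have "min_agg (grades D Z) \<le> ?g 0 + ?g 1"
      using m by (simp add: grades_conv_upt[OF lenD] min_agg_map_upt)
    ultimately show ?thesis by simp
  qed
  show "top_k min_agg k D (f ` winners R)"
    unfolding top_k_def using sub card_winners R others by (auto simp: win)
qed

subsection \<open>The adversary argument\<close>

text \<open>\<open>S\<close> affects only the lists from 2 on, and there only places beyond the
  first \<open>M\<close>, which \<open>h\<close> is too short to reach; a random access depends on a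
  single pair.\<close>

lemma reply_db_eq:
  assumes "length h < M" and "\<And>j i. q = Random (f j) i \<Longrightarrow> (j, i) \<in> S \<longleftrightarrow> (j, i) \<in> S'"
  shows "reply (db S) h q = reply (db S') h q"
proof (cases q)
  case (Sorted i)
  have "db S ! i ! p = db S' ! i ! p" if "i < m" "p < M" for p
  proof (cases "i < 2")
    case True
    then have "ranking S i = ranking S' i" "field_grade S i = field_grade S' i"
      by (auto simp: ranking_def field_grade_def fun_eq_iff)
    then show ?thesis using \<open>i < m\<close> by (simp add: nth_db)
  next
    case False
    then show ?thesis
      using that by (auto simp: nth_db length_ranking ranking_def nth_append field_grade_def)
  qed
  moreover have "num_accesses (\<lambda>q. q = Sorted i) h < M"
    using num_accesses_le_length assms(1) by (rule le_less_trans)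
  ultimately show ?thesis by (simp add: Sorted Let_def nth_db length_ranking)
next
  case (Random R i)
  show ?thesis
  proof (cases "i < m \<and> R \<in> f ` {0..<n+M}")
    case True
    then obtain j where j: "R = f j" "j < n + M" by auto
    with assms(2) Random have "field_grade S i j = field_grade S' i j"
      by (simp add: field_grade_def)
    with j True Random show ?thesis by (simp add: map_of_db)
  next
    case False
    then show ?thesis using Random by (auto simp: map_of_db_None)
  qed
qed

text \<open>Equal answers make a deterministic algorithm choose the same next access, so the runs
  can part only at an accessed pair on which \<open>S\<close> and \<open>S'\<close> differ.\<close>

lemma run_db_eq:
  assumes "s \<le> M"
    and "\<And>j i. Random (f j) i \<in> fst ` set (run B (db S) s) \<Longrightarrow> (j, i) \<in> S \<longleftrightarrow> (j, i) \<in> S'"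
  shows "run B (db S') s = run B (db S) s"
  using assms
proof (induction s)
  case (Suc s)
  have sub: "set (run B (db S) s) \<subseteq> set (run B (db S) (Suc s))"
    using run_mono[of s "Suc s" B "db S"] by auto
  have IH: "run B (db S') s = run B (db S) s"
    using Suc.prems sub by (intro Suc.IH) auto
  show ?case
  proof (cases "B (run B (db S) s)")
    case (Access q)
    have "length (run B (db S) s) < M"
      using length_run[of B "db S" s] Suc.prems(1) by simp
    moreover have "(j, i) \<in> S \<longleftrightarrow> (j, i) \<in> S'" if "q = Random (f j) i" for j i
      using that Access by (intro Suc.prems(2)) (simp add: Let_def)
    ultimately have "reply (db S) (run B (db S) s) q = reply (db S') (run B (db S) s) q"
      by (rule reply_db_eq)
    then show ?thesis using Access IH by (simp add: Let_def)
  qed (simp add: IH Let_def)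
qed simp

text \<open>Only the lists from 2 on count, since \<open>S\<close> leaves the first two grades
  unchanged.\<close>

definition fully_accessed :: "'a history \<Rightarrow> nat \<Rightarrow> bool" where
  "fully_accessed h j \<longleftrightarrow> (\<forall>i\<in>{2..<m}. Random (f j) i \<in> fst ` set h)"

lemma fully_accessed_mono: "fully_accessed h j \<Longrightarrow> fully_accessed (h @ h') j"
  by (auto simp: fully_accessed_def)

text \<open>
  The adversary answers high to every random access, except that the access that completes the
  fields of a contender is answered low, as long as another contender remains. Since an answer
  not yet given may still be changed, this is expressed by enlarging \<open>S\<close> during the run.
\<close>

lemma adversary_strategy:
  assumes "s \<le> M"
  shows "\<exists>S \<subseteq> {k - 1..<n} \<times> {2..<m}.
    (\<forall>j\<in>fst ` S. fully_accessed (run B (db S) s) j) \<and> card (fst ` S) \<le> n - k \<and>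
    (card (fst ` S) = n - k \<or> (\<forall>j\<in>{k - 1..<n} - fst ` S. \<not> fully_accessed (run B (db S) s) j))"
  using assms
proof (induction s)
  case 0
  have "2 \<in> {2..<m}" using m by simp
  then have "\<not> fully_accessed [] j" for j by (auto simp: fully_accessed_def)
  then show ?case by (intro exI[of _ "{}"]) simp
next
  case (Suc s)
  then obtain S where S: "S \<subseteq> {k - 1..<n} \<times> {2..<m}"
    "\<And>j. j \<in> fst ` S \<Longrightarrow> fully_accessed (run B (db S) s) j" "card (fst ` S) \<le> n - k"
    "card (fst ` S) = n - k \<or> (\<forall>j\<in>{k - 1..<n} - fst ` S. \<not> fully_accessed (run B (db S) s) j)"
    by auto
  let ?h = "run B (db S) s"
  obtain ys where ys: "run B (db S) (Suc s) = ?h @ ys" using run_mono[of s "Suc s" B "db S"] by auto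
  have full: "fully_accessed (run B (db S) (Suc s)) j" if "j \<in> fst ` S" for j
    unfolding ys using S(2)[OF that] by (rule fully_accessed_mono)
  show ?case
  proof (cases "card (fst ` S) = n - k \<or>
      (\<forall>j\<in>{k - 1..<n} - fst ` S. \<not> fully_accessed (run B (db S) (Suc s)) j)")
    case True
    then show ?thesis using S(1,3) full by blast
  next
    case False
    then obtain j where j: "j \<in> {k - 1..<n}" "j \<notin> fst ` S"
      "fully_accessed (run B (db S) (Suc s)) j" and less: "card (fst ` S) < n - k"
      using S(3) by auto
    have nfull: "\<not> fully_accessed ?h j'" if "j' \<in> {k - 1..<n} - fst ` S" for j'
      using S(4) less that by auto
    obtain q where q: "B ?h = Access q"
      using j nfull[of j] by (cases "B ?h") (auto simp: Let_def)
    \<comment> \<open>Since \<open>j\<close> becomes fully accessed only now, this step is a random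
      access to its last missing field \<open>i\<close>. Making that field low alters none of the
      earlier answers.\<close>
    obtain i where i: "i \<in> {2..<m}" "q = Random (f j) i" "Random (f j) i \<notin> fst ` set ?h"
      using j nfull[of j] q by (auto simp: Let_def fully_accessed_def)
    let ?S = "insert (j, i) S"
    have run: "run B (db ?S) s = ?h"
      using i(3) Suc.prems inj by (intro run_db_eq) (auto simp: inj_eq)
    then obtain a where run': "run B (db ?S) (Suc s) = ?h @ [(q, a)]"
      using q by (simp add: Let_def)
    \<comment> \<open>The last answer may change, but \<open>fully_accessed\<close> looks only at
      the accesses; and the one new access concerns \<open>j\<close>, so no other contender is
      completed.\<close>
    have "fst ` set (run B (db S) (Suc s)) = fst ` set (run B (db ?S) (Suc s))"
      using run' q by (simp add: Let_def)
    then have fa: "fully_accessed (run B (db ?S) (Suc s)) = fully_accessed (run B (db S) (Suc s))"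
      by (simp add: fully_accessed_def fun_eq_iff)
    have "\<not> fully_accessed (run B (db ?S) (Suc s)) j'"
      if "j' \<in> {k - 1..<n} - fst ` ?S" for j'
    proof
      assume "fully_accessed (run B (db ?S) (Suc s)) j'"
      then have "fully_accessed ?h j'"
        using that i inj unfolding run' by (auto simp: fully_accessed_def inj_eq)
      then show False using nfull[of j'] that by auto
    qed
    moreover have "card (fst ` ?S) \<le> n - k"
      using less finite_subset[OF S(1)] by (simp add: card_insert_if)
    moreover have "?S \<subseteq> {k - 1..<n} \<times> {2..<m}" using S(1) i(1) j(1) by auto
    moreover have "\<forall>j'\<in>fst ` ?S. fully_accessed (run B (db ?S) (Suc s)) j'"
      unfolding fa using full j(3) by auto
    ultimately show ?thesis by blast
  qed
qed

lemma random_accesses_ge: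
  assumes "finite J" "\<And>j. j \<in> J \<Longrightarrow> fully_accessed h j"
  shows "card J * (m - 2) \<le> num_accesses (\<lambda>q. \<exists>R i. q = Random R i) h"
proof -
  let ?Q = "(\<lambda>(j, i). Random (f j) i) ` (J \<times> {2..<m})"
  have inj_Q: "inj_on (\<lambda>(j, i). Random (f j) i) (J \<times> {2..<m})"
    by (auto simp: inj_on_def inj_eq[OF inj])
  have "?Q \<subseteq> set (filter (\<lambda>q. \<exists>R i. q = Random R i) (map fst h))"
    using assms(2) by (auto simp: fully_accessed_def)
  then have "card ?Q \<le> card (set (filter (\<lambda>q. \<exists>R i. q = Random R i) (map fst h)))"
    by (intro card_mono) simp_all
  also have "\<dots> \<le> num_accesses (\<lambda>q. \<exists>R i. q = Random R i) h"
    unfolding num_accesses_conv_filter by (rule card_length)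
  finally show ?thesis using inj_Q by (simp add: card_image card_cartesian_product)
qed

text \<open>If \<open>n - k\<close> candidates have been made low, one contender remains and the
  random accesses are counted. Otherwise at least two contenders have an unread field; sparing
  either one gives the same first \<open>M\<close> steps but a different top \<open>k\<close>, so
  \<open>B\<close> cannot have halted.\<close>

lemma adversary_outcome:
  assumes B: "B \<in> correct_algorithms min_agg k (distinct_databases m k)"
  obtains S R where "S \<subseteq> {k - 1..<n} \<times> {2..<m}" "fst ` S = {k - 1..<n} - {R}"
    "R \<in> {k - 1..<n}"
    "(n - k) * (m - 2) \<le> num_accesses (\<lambda>q. \<exists>R i. q = Random R i) (run B (db S) M) \<or>
     length (run B (db S) M) = M"
proof -
  obtain S where S: "S \<subseteq> {k - 1..<n} \<times> {2..<m}"
    "\<And>j. j \<in> fst ` S \<Longrightarrow> fully_accessed (run B (db S) M) j" "card (fst ` S) \<le> n - k"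
    "card (fst ` S) = n - k \<or> (\<forall>j\<in>{k - 1..<n} - fst ` S. \<not> fully_accessed (run B (db S) M) j)"
    using adversary_strategy[of M B] by auto
  let ?U = "{k - 1..<n} - fst ` S"
  have sub: "fst ` S \<subseteq> {k - 1..<n}" using S(1) by auto
  then have fin: "finite (fst ` S)" using finite_subset by blast
  have cardU: "card ?U = n - (k - 1) - card (fst ` S)"
    using sub fin by (simp add: card_Diff_subset)
  show ?thesis
  proof (cases "card (fst ` S) = n - k")
    case True
    with cardU have "card ?U = 1" using k kn by simp
    then obtain R where R: "?U = {R}" by (meson card_1_singletonE)
    then have "fst ` S = {k - 1..<n} - {R}" "R \<in> {k - 1..<n}" using sub by auto
    moreover have "(n - k) * (m - 2) \<le> num_accesses (\<lambda>q. \<exists>R i. q = Random R i) (run B (db S) M)"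
      using random_accesses_ge[OF fin S(2)] True by simp
    ultimately show ?thesis using that[OF S(1)] by blast
  next
    case False
    then have nfull: "\<exists>i\<in>{2..<m}. Random (f j) i \<notin> fst ` set (run B (db S) M)" if "j \<in> ?U" for j
      using S(4) that unfolding fully_accessed_def by blast
    then obtain u where u: "\<And>j. j \<in> ?U \<Longrightarrow> u j \<in> {2..<m} \<and>
        Random (f j) (u j) \<notin> fst ` set (run B (db S) M)" by metis
    \<comment> \<open>\<open>T R\<close> lowers an unread field of every contender except
      \<open>R\<close>, which becomes the sole survivor.\<close>
    define T where "T R = S \<union> (\<lambda>j. (j, u j)) ` (?U - {R})" for R
    have T: "T R \<subseteq> {k - 1..<n} \<times> {2..<m}" "fst ` T R = {k - 1..<n} - {R}"
      "R \<in> {k - 1..<n}" "run B (db (T R)) M = run B (db S) M" if "R \<in> ?U" for R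
    proof -
      show "T R \<subseteq> {k - 1..<n} \<times> {2..<m}" using S(1) u by (auto simp: T_def)
      have "fst ` T R = fst ` S \<union> (?U - {R})" by (simp add: T_def image_Un image_image)
      then show "fst ` T R = {k - 1..<n} - {R}" using sub that by auto
      show "R \<in> {k - 1..<n}" using that by simp
      show "run B (db (T R)) M = run B (db S) M"
        unfolding T_def using u by (intro run_db_eq) blast+
    qed
    have "\<not> card ?U \<le> Suc 0" using cardU False S(3) k kn by simp
    then obtain R R' where R: "R \<in> ?U" "R' \<in> ?U" "R \<noteq> R'"
      using card_le_Suc0_iff_eq[of ?U] by auto
    have "\<not> halts_after B (db S) M X" for X
    proof
      assume X: "halts_after B (db S) M X"
      have "X = f ` winners Z" if Z: "Z \<in> ?U" for Z
      proof -
        obtain l Y where Y: "halts_after B (db (T Z)) l Y" "top_k min_agg k (db (T Z)) Y"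
          using B db_in_distinct_databases unfolding correct_algorithms_def by blast
        have X': "halts_after B (db (T Z)) M X" using X T(4)[OF Z] by (simp add: halts_after_def)
        \<comment> \<open>The history is frozen from the earlier of the two halting times on, so
          both outputs coincide.\<close>
        have "X = Y"
          using run_after_halt[OF Y(1), of M] run_after_halt[OF X', of l] X' Y(1)
          by (cases "l \<le> M") (auto simp: halts_after_def)
        then show ?thesis using top_k_unique[OF T(1-3)[OF Z] Y(2)] by simp
      qed
      then have "f ` winners R = f ` winners R'" using R by metis
      then have "winners R = winners R'" using inj by (simp add: inj_image_eq_iff)
      then show False using R by (auto simp: winners_def)
    qed
    then have "length (run B (db S) M) = M" by (rule length_run_not_halted)
    then show ?thesis using that[OF T(1-3)[OF R(1)]] T(4)[OF R(1)] by simp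
  qed
qed

end

section \<open>Choice of the parameters and comparison of the costs\<close>

theorem theorem9p2:
  fixes k m :: nat and cS cR :: real
  assumes "1 \<le> k" and "3 \<le> m" and "0 < cS" and "0 < cR"
  shows "\<not> (\<exists>(B :: 'a::infinite algorithm) c.
            instance_optimal cS cR
              (correct_algorithms min_agg k (distinct_databases m k))
              (distinct_databases m k) B c \<and>
            c < (real m - 2) / 2 * (cR / cS))"
proof clarify
  fix B :: "'a algorithm" and c
  let ?\<D> = "distinct_databases m k :: 'a database set"
  let ?\<A> = "correct_algorithms min_agg k ?\<D>"
  assume opt: "instance_optimal cS cR ?\<A> ?\<D> B c"
    and c: "c < (real m - 2) / 2 * (cR / cS)"
  obtain c' where B: "B \<in> ?\<A>"
    and c': "\<And>A D. A \<in> ?\<A> \<Longrightarrow> D \<in> ?\<D> \<Longrightarrow> cost cS cR B D \<le> c * cost cS cR A D + c'"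
    using opt unfolding instance_optimal_def by blast
  obtain f :: "nat \<Rightarrow> 'a" where f: "inj f"
    using infinite_countable_subset[OF infinite_UNIV] by blast
  \<comment> \<open>\<open>c\<close> may be negative, whereas multiplying an upper bound on the cost
    of the competitor calls for a nonnegative factor.\<close>
  define b where "b = max c 0"
  have b: "0 \<le> b" "c \<le> b" by (simp_all add: b_def)
  have "b < (real m - 2) / 2 * (cR / cS)" using c assms by (simp add: b_def)
  then have "0 < (real m - 2) * cR - 2 * b * cS"
    using assms by (simp add: field_simps)
  \<comment> \<open>\<open>e\<close> counts the candidates beyond \<open>k\<close>. Each adds
    \<open>(m - 2) * cR\<close> to the forced cost and \<open>2 * b * cS\<close> to the allowance,
    so a large \<open>e\<close> outweighs the constant terms.\<close>
  then obtain e :: nat where e: "b * (2 * (real k + 1) * cS + real (k * m) * cR) + c'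
      < real e * ((real m - 2) * cR - 2 * b * cS)"
    using ex_less_of_nat_mult by blast
  define n where "n = k + e"
  define C where "C = real (2 * (n + 1)) * cS + real (k * m) * cR"
  have C: "b * C + c' < real (e * (m - 2)) * cR"
    using e assms by (simp add: C_def n_def algebra_simps of_nat_diff)
  have "0 < min cS cR" using assms by simp
  then obtain M where M_large: "b * C + c' < real M * min cS cR" using ex_less_of_nat_mult by blast
  interpret adversary f m k n "Suc M"
    using f assms by unfold_locales (simp_all add: n_def)
  obtain S R where S: "S \<subseteq> {k - 1..<n} \<times> {2..<m}" "fst ` S = {k - 1..<n} - {R}" "R \<in> {k - 1..<n}"
    and or: "(n - k) * (m - 2) \<le> num_accesses (\<lambda>q. \<exists>R i. q = Random R i) (run B (db S) (Suc M)) \<or>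
       length (run B (db S) (Suc M)) = Suc M"
    using adversary_outcome[OF B] by metis
  have D: "db S \<in> ?\<D>" by (rule db_in_distinct_databases)
  \<comment> \<open>That every database has a top \<open>k\<close> set is read off from the
    correctness of \<open>B\<close>.\<close>
  have top_ex: "\<exists>X. top_k min_agg k D X" if "D \<in> ?\<D>" for D
    using B that unfolding correct_algorithms_def by blast
  let ?A = "certifying min_agg k ?\<D> m (certificate R)"
  have A: "?A \<in> ?\<A>"
    using top_ex by (intro certifying_correct) (auto simp: distinct_databases_def is_database_def)
  have "cost cS cR ?A (db S) \<le> C"
    unfolding C_def length_filter_certificate[of R, symmetric]
    using certificate_determines[OF S] assms by (intro cost_certifying_le) auto
  moreover have "0 \<le> cost cS cR ?A (db S)" unfolding cost_def using assms by simp
  ultimately have "c * cost cS cR ?A (db S) \<le> b * C"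
    using b by (meson mult_left_mono mult_right_mono order_trans)
  then have upper: "cost cS cR B (db S) \<le> b * C + c'" using c'[OF A D] by linarith
  obtain l X where halt: "halts_after B (db S) l X"
    using B D unfolding correct_algorithms_def by blast
  from or show False
  proof
    assume "(n - k) * (m - 2) \<le> num_accesses (\<lambda>q. \<exists>R i. q = Random R i) (run B (db S) (Suc M))"
    then have "real (e * (m - 2)) * cR
        \<le> real (num_accesses (\<lambda>q. \<exists>R i. q = Random R i) (run B (db S) (Suc M))) * cR"
      using assms by (intro mult_right_mono of_nat_mono) (simp_all add: n_def)
    also have "\<dots> \<le> cost cS cR B (db S)" using assms by (intro cost_ge_random[OF halt]) simp_all
    finally show False using C upper by linarith
  next
    assume "length (run B (db S) (Suc M)) = Suc M"
    then have "real (Suc M) * min cS cR \<le> cost cS cR B (db S)"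
      using cost_ge_length[OF halt, of cS cR "Suc M"] assms by (simp del: run.simps)
    moreover have "real M * min cS cR \<le> real (Suc M) * min cS cR"
      using assms by (intro mult_right_mono) simp_all
    ultimately show False using M_large upper by linarith
  qed
qed

end
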